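(* Let $\sigma$ be a finite relational signature, $X$ a set of $\sigma$-structures, $\tau$ a topology on $X$, and suppose $\langle X,\tau,\mathsf{FO}[\sigma]\rangle$ is a logically presented pre-spectral space. Let $Y\subseteq X$ be a (finite) Boolean combination of compact-open subsets of the space $\langle X,\tau,\mathsf{FO}[\sigma]\rangle$, and let $\theta$ be the topology induced by $\tau$ on $Y$. Then $\langle Y,\theta,\mathsf{FO}[\sigma]\rangle$ is a logically presented pre-spectral space.
   Context: "Compact" means every open cover has a finite subcover (no separation axiom). For a set $X$, a topology $\tau$ on $X$ and a sublattice $\mathcal{L}$ of $\wp(X)$ containing $\emptyset$ and $X$, $\langle X,\tau,\mathcal{L}\rangle$ denotes the space $X$ with the topology $\langle\tau\cap\mathcal{L}\rangle$ generated by $\tau\cap\mathcal{L}$; it is a logically presented pre-spectral space if every element of $\tau\cap\mathcal{L}$ is compact in this topology. When $X$ is a set of $\sigma$-structures, $\langle X,\tau,\mathsf{FO}[\sigma]\rangle$ stands for $\langle X,\tau,\mathcal{L}\rangle$ with $\mathcal{L}=\{[\![\varphi]\!]_X \mid \varphi \text{ a first-order } \sigma\text{-sentence}\}$, where $[\![\varphi]\!]_X=\{A\in X\mid A\models\varphi\}$ (equality is always available in first-order logic). *)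

theory Defs
  imports "HOL-Analysis.Analysis"
begin

section \<open>Relational structures\<close>

text \<open>
  The symbols of a relational signature are the elements of its domain, and the signature sends
  each symbol to its arity (nullary symbols are allowed).
\<close>

type_synonym 'r rel_signature = "'r \<Rightarrow> nat option"

definition finite_signature :: "'r rel_signature \<Rightarrow> bool" where
  "finite_signature \<sigma> \<longleftrightarrow> finite (dom \<sigma>)"

record ('r, 'a) rel_structure =
  universe :: "'a set"
  interp :: "'r \<Rightarrow> 'a list set"

text \<open>
  Symbols outside the signature are interpreted by the empty set, so that two \<open>\<sigma>\<close>-structures are
  equal in HOL iff they have the same universe and the same relations. The empty universe is not
  excluded.
\<close>

definition is_structure :: "'r rel_signature \<Rightarrow> ('r, 'a) rel_structure \<Rightarrow> bool" where
  "is_structure \<sigma> A \<longleftrightarrow>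
     (\<forall>R. case \<sigma> R of
            None \<Rightarrow> interp A R = {}
          | Some n \<Rightarrow> interp A R \<subseteq> {as. length as = n \<and> set as \<subseteq> universe A})"


section \<open>First-order logic with equality\<close>

text \<open>Variables are natural numbers; the remaining connectives and \<open>\<forall>\<close> are definable.\<close>

datatype 'r fo =
    Falsum
  | Eq nat nat
  | Rel 'r "nat list"
  | Neg "'r fo"
  | Conj "'r fo" "'r fo"
  | Exists nat "'r fo"

primrec fo_formula :: "'r rel_signature \<Rightarrow> 'r fo \<Rightarrow> bool" where
  "fo_formula \<sigma> Falsum \<longleftrightarrow> True"
| "fo_formula \<sigma> (Eq x y) \<longleftrightarrow> True"
| "fo_formula \<sigma> (Rel R xs) \<longleftrightarrow> \<sigma> R = Some (length xs)"
| "fo_formula \<sigma> (Neg \<phi>) \<longleftrightarrow> fo_formula \<sigma> \<phi>"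
| "fo_formula \<sigma> (Conj \<phi> \<psi>) \<longleftrightarrow> fo_formula \<sigma> \<phi> \<and> fo_formula \<sigma> \<psi>"
| "fo_formula \<sigma> (Exists x \<phi>) \<longleftrightarrow> fo_formula \<sigma> \<phi>"

primrec free_vars :: "'r fo \<Rightarrow> nat set" where
  "free_vars Falsum = {}"
| "free_vars (Eq x y) = {x, y}"
| "free_vars (Rel R xs) = set xs"
| "free_vars (Neg \<phi>) = free_vars \<phi>"
| "free_vars (Conj \<phi> \<psi>) = free_vars \<phi> \<union> free_vars \<psi>"
| "free_vars (Exists x \<phi>) = free_vars \<phi> - {x}"

definition fo_sentence :: "'r rel_signature \<Rightarrow> 'r fo \<Rightarrow> bool" where
  "fo_sentence \<sigma> \<phi> \<longleftrightarrow> fo_formula \<sigma> \<phi> \<and> free_vars \<phi> = {}"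

primrec sat :: "('r, 'a) rel_structure \<Rightarrow> (nat \<Rightarrow> 'a) \<Rightarrow> 'r fo \<Rightarrow> bool" where
  "sat A v Falsum \<longleftrightarrow> False"
| "sat A v (Eq x y) \<longleftrightarrow> v x = v y"
| "sat A v (Rel R xs) \<longleftrightarrow> map v xs \<in> interp A R"
| "sat A v (Neg \<phi>) \<longleftrightarrow> \<not> sat A v \<phi>"
| "sat A v (Conj \<phi> \<psi>) \<longleftrightarrow> sat A v \<phi> \<and> sat A v \<psi>"
| "sat A v (Exists x \<phi>) \<longleftrightarrow> (\<exists>a \<in> universe A. sat A (v(x := a)) \<phi>)"

lemma sat_cong:
  "(\<And>x. x \<in> free_vars \<phi> \<Longrightarrow> v x = w x) \<Longrightarrow> sat A v \<phi> \<longleftrightarrow> sat A w \<phi>"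
proof (induction \<phi> arbitrary: v w)
  case (Rel R xs)
  then have "map v xs = map w xs" by simp
  then show ?case by (simp only: sat.simps)
next
  case (Exists x \<phi>)
  have "sat A (v(x := a)) \<phi> \<longleftrightarrow> sat A (w(x := a)) \<phi>" for a
    using Exists.prems by (intro Exists.IH) auto
  then show ?case by simp
next
  case (Conj \<phi> \<psi>)
  have "sat A v \<phi> \<longleftrightarrow> sat A w \<phi>" using Conj.prems by (intro Conj.IH(1)) auto
  moreover have "sat A v \<psi> \<longleftrightarrow> sat A w \<psi>" using Conj.prems by (intro Conj.IH(2)) auto
  ultimately show ?case by simp
next
  case (Neg \<phi>)
  have "sat A v \<phi> \<longleftrightarrow> sat A w \<phi>" using Neg.prems by (intro Neg.IH) simp
  then show ?case by simp
qed simp_all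

text \<open>
  On sentences the quantification over valuations is vacuous, by lemma \<open>models_sentence\<close>. Valuations are
  total functions into the type \<open>'a\<close> and need not take values in the universe, so this also gives
  the intended meaning in the empty structure.
\<close>

definition models :: "('r, 'a) rel_structure \<Rightarrow> 'r fo \<Rightarrow> bool" where
  "models A \<phi> \<longleftrightarrow> (\<forall>v. sat A v \<phi>)"

lemma models_sentence: "fo_sentence \<sigma> \<phi> \<Longrightarrow> models A \<phi> \<longleftrightarrow> sat A v \<phi>"
proof -
  assume "fo_sentence \<sigma> \<phi>"
  then have "sat A w \<phi> \<longleftrightarrow> sat A v \<phi>" for w
    by (intro sat_cong) (simp add: fo_sentence_def)
  then show ?thesis unfolding models_def by metis
qed

definition models_in :: "('r, 'a) rel_structure set \<Rightarrow> 'r fo \<Rightarrow> ('r, 'a) rel_structure set" where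
  "models_in X \<phi> = {A \<in> X. models A \<phi>}"

definition FO :: "'r rel_signature \<Rightarrow> ('r, 'a) rel_structure set \<Rightarrow> ('r, 'a) rel_structure set set"
  where "FO \<sigma> X = {models_in X \<phi> | \<phi>. fo_sentence \<sigma> \<phi>}"


section \<open>Logically presented pre-spectral spaces\<close>

definition bounded_sublattice :: "'x set \<Rightarrow> 'x set set \<Rightarrow> bool" where
  "bounded_sublattice X L \<longleftrightarrow>
     L \<subseteq> Pow X \<and> {} \<in> L \<and> X \<in> L \<and> (\<forall>U \<in> L. \<forall>V \<in> L. U \<union> V \<in> L \<and> U \<inter> V \<in> L)"

definition presented_opens :: "'x topology \<Rightarrow> 'x set set \<Rightarrow> 'x set set" where
  "presented_opens \<tau> L = {U. openin \<tau> U} \<inter> L"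

text \<open>The space \<open>\<langle>X, \<tau>, L\<rangle>\<close>, where \<open>X\<close> is the topspace of \<open>\<tau>\<close>.\<close>

definition presented_space :: "'x topology \<Rightarrow> 'x set set \<Rightarrow> 'x topology" where
  "presented_space \<tau> L = topology_generated_by (presented_opens \<tau> L)"

definition logically_presented_pre_spectral :: "'x set \<Rightarrow> 'x topology \<Rightarrow> 'x set set \<Rightarrow> bool" where
  "logically_presented_pre_spectral X \<tau> L \<longleftrightarrow>
     topspace \<tau> = X \<and> bounded_sublattice X L \<and>
     (\<forall>U \<in> presented_opens \<tau> L. compactin (presented_space \<tau> L) U)"

lemma topspace_presented_space:
  "topspace \<tau> = X \<Longrightarrow> bounded_sublattice X L \<Longrightarrow> topspace (presented_space \<tau> L) = X"
  unfolding presented_space_def presented_opens_def bounded_sublattice_def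
    topology_generated_by_topspace by auto

definition compact_opens :: "'x topology \<Rightarrow> 'x set set" where
  "compact_opens T = {K. openin T K \<and> compactin T K}"

inductive_set boolean_combinations :: "'x set \<Rightarrow> 'x set set \<Rightarrow> 'x set set"
  for X :: "'x set" and C :: "'x set set" where
  base: "K \<in> C \<Longrightarrow> K \<in> boolean_combinations X C"
| compl: "Y \<in> boolean_combinations X C \<Longrightarrow> X - Y \<in> boolean_combinations X C"
| union: "Y \<in> boolean_combinations X C \<Longrightarrow> Z \<in> boolean_combinations X C
    \<Longrightarrow> Y \<union> Z \<in> boolean_combinations X C"
| inter: "Y \<in> boolean_combinations X C \<Longrightarrow> Z \<in> boolean_combinations X C
    \<Longrightarrow> Y \<inter> Z \<in> boolean_combinations X C"

end

theory Submission
  imports Defs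
begin

text \<open>
  A compact-open set of the presented space is a finite union of presented opens, hence itself
  presented, so \<open>Y\<close> is a finite union of differences \<open>K - K'\<close> of presented opens. On such a piece a
  presented open \<open>V\<close> of the subspace need not be the trace of a presented open of \<open>X\<close>, but
  \<open>V \<union> (K \<inter> K')\<close> is open and definable in \<open>X\<close>. Adding \<open>K \<inter> K'\<close> to \<open>V\<close> and to every member of a
  cover of \<open>V\<close> therefore transfers compactness from \<open>X\<close> to the piece, and a finite union of pieces
  inherits it. Of first-order logic only closure under Boolean operations matters.
\<close>

section \<open>Compactness tested on a base\<close>

text \<open>Closure of \<open>B\<close> under binary intersections upgrades the generating family
  from a subbase to a base.\<close>

lemma generate_topology_on_base:
  assumes "generate_topology_on B U" "x \<in> U"
    and int: "\<And>U V. U \<in> B \<Longrightarrow> V \<in> B \<Longrightarrow> U \<inter> V \<in> B"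
  shows "\<exists>W\<in>B. x \<in> W \<and> W \<subseteq> U"
  using assms(1,2)
proof (induction arbitrary: x)
  case (Int U V)
  obtain W where W: "W \<in> B" "x \<in> W" "W \<subseteq> U" using Int.IH(1)[of x] Int.prems by auto
  obtain W' where W': "W' \<in> B" "x \<in> W'" "W' \<subseteq> V" using Int.IH(2)[of x] Int.prems by auto
  have "W \<inter> W' \<in> B" using W(1) W'(1) by (rule int)
  then show ?case using W W' by (intro bexI[of _ "W \<inter> W'"]) auto
next
  case (UN K)
  then obtain U where U: "U \<in> K" "x \<in> U" by auto
  then obtain W where "W \<in> B" "x \<in> W" "W \<subseteq> U" using UN.IH[of U x] by auto
  then show ?case using U by blast
qed auto

text \<open>Since \<open>B\<close> is a base, the basic sets lying inside some member of an open
  cover still cover \<open>S\<close>. Finitely many of them suffice, and each is then replaced by a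
  cover member containing it.\<close>

lemma compactin_topology_generated_by_iff:
  assumes int: "\<And>U V. U \<in> B \<Longrightarrow> V \<in> B \<Longrightarrow> U \<inter> V \<in> B"
  shows "compactin (topology_generated_by B) S \<longleftrightarrow>
    S \<subseteq> \<Union>B \<and> (\<forall>\<C>\<subseteq>B. S \<subseteq> \<Union>\<C> \<longrightarrow> (\<exists>\<D>\<subseteq>\<C>. finite \<D> \<and> S \<subseteq> \<Union>\<D>))"
    (is "?compact \<longleftrightarrow> ?fincover")
proof
  assume c: ?compact
  have op: "openin (topology_generated_by B) U" if "U \<in> B" for U
    using that by (rule topology_generated_by_Basis)
  show ?fincover
  proof (intro conjI allI impI)
    show "S \<subseteq> \<Union>B"
      using compactin_subset_topspace[OF c] by simp
    fix \<C> assume "\<C> \<subseteq> B" "S \<subseteq> \<Union>\<C>"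
    then show "\<exists>\<D>\<subseteq>\<C>. finite \<D> \<and> S \<subseteq> \<Union>\<D>"
      using compactinD[OF c, of \<C>] op by blast
  qed
next
  assume f: ?fincover
  show ?compact
    unfolding compactin_def
  proof (intro conjI allI impI)
    show "S \<subseteq> topspace (topology_generated_by B)"
      using f by simp
    fix \<U> assume \<U>: "Ball \<U> (openin (topology_generated_by B)) \<and> S \<subseteq> \<Union>\<U>"
    define \<C> where "\<C> = {W \<in> B. \<exists>U\<in>\<U>. W \<subseteq> U}"
    have "S \<subseteq> \<Union>\<C>"
    proof
      fix x assume "x \<in> S"
      then obtain U where U: "U \<in> \<U>" "x \<in> U" using \<U> by blast
      then have "generate_topology_on B U"
        using \<U> by (simp add: openin_topology_generated_by_iff)
      from generate_topology_on_base[OF this U(2) int] U(1) show "x \<in> \<Union>\<C>" by (auto simp: \<C>_def)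
    qed
    moreover have "\<C> \<subseteq> B" by (auto simp: \<C>_def)
    ultimately obtain \<D> where \<D>: "\<D> \<subseteq> \<C>" "finite \<D>" "S \<subseteq> \<Union>\<D>" using f by blast
    have "\<forall>W\<in>\<D>. \<exists>U. U \<in> \<U> \<and> W \<subseteq> U" using \<D>(1) by (auto simp: \<C>_def)
    then obtain h where h: "\<forall>W\<in>\<D>. h W \<in> \<U> \<and> W \<subseteq> h W" by metis
    show "\<exists>\<F>. finite \<F> \<and> \<F> \<subseteq> \<U> \<and> S \<subseteq> \<Union>\<F>"
      using \<D> h by (intro exI[of _ "h ` \<D>"]) blast
  qed
qed

section \<open>The lattice of presented opens\<close>

lemma presented_opens_Int:
  "bounded_sublattice X L \<Longrightarrow> U \<in> presented_opens \<tau> L \<Longrightarrow> V \<in> presented_opens \<tau> L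
    \<Longrightarrow> U \<inter> V \<in> presented_opens \<tau> L"
  by (auto simp: presented_opens_def bounded_sublattice_def)

lemma presented_opens_Un:
  "bounded_sublattice X L \<Longrightarrow> U \<in> presented_opens \<tau> L \<Longrightarrow> V \<in> presented_opens \<tau> L
    \<Longrightarrow> U \<union> V \<in> presented_opens \<tau> L"
  by (auto simp: presented_opens_def bounded_sublattice_def)

lemma presented_opens_empty: "bounded_sublattice X L \<Longrightarrow> {} \<in> presented_opens \<tau> L"
  by (simp add: presented_opens_def bounded_sublattice_def)

lemma presented_opens_top:
  "bounded_sublattice X L \<Longrightarrow> topspace \<tau> = X \<Longrightarrow> X \<in> presented_opens \<tau> L"
  by (auto simp: presented_opens_def bounded_sublattice_def)

lemma presented_opens_Union:
  assumes "bounded_sublattice X L" "finite F" "F \<subseteq> presented_opens \<tau> L"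
  shows "\<Union>F \<in> presented_opens \<tau> L"
  using assms(2,3)
  by (induction F)
    (simp_all add: presented_opens_empty[OF assms(1)] presented_opens_Un[OF assms(1)])

text \<open>The factor \<open>X\<close> handles the empty family, whose intersection is
  \<open>UNIV\<close>.\<close>

lemma presented_opens_Inter:
  assumes "bounded_sublattice X L" "topspace \<tau> = X" "finite F" "F \<subseteq> presented_opens \<tau> L"
  shows "X \<inter> \<Inter>F \<in> presented_opens \<tau> L"
  using assms(3,4)
proof (induction F)
  case empty
  then show ?case using presented_opens_top[OF assms(1,2)] by simp
next
  case (insert U F)
  then have "U \<inter> (X \<inter> \<Inter>F) \<in> presented_opens \<tau> L"
    using presented_opens_Int[OF assms(1)] by simp
  moreover have "X \<inter> \<Inter>(insert U F) = U \<inter> (X \<inter> \<Inter>F)" by blast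
  ultimately show ?case by simp
qed

lemma compactin_presented_space_iff:
  assumes "bounded_sublattice X L"
  shows "compactin (presented_space \<tau> L) S \<longleftrightarrow>
    S \<subseteq> \<Union>(presented_opens \<tau> L) \<and>
    (\<forall>\<C>\<subseteq>presented_opens \<tau> L. S \<subseteq> \<Union>\<C> \<longrightarrow> (\<exists>\<D>\<subseteq>\<C>. finite \<D> \<and> S \<subseteq> \<Union>\<D>))"
  unfolding presented_space_def
  by (rule compactin_topology_generated_by_iff) (rule presented_opens_Int[OF assms])

lemma compact_opens_presented_space:
  assumes "bounded_sublattice X L"
  shows "compact_opens (presented_space \<tau> L) \<subseteq> presented_opens \<tau> L"
proof
  fix K assume "K \<in> compact_opens (presented_space \<tau> L)"
  then have op: "generate_topology_on (presented_opens \<tau> L) K"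
    and c: "compactin (presented_space \<tau> L) K"
    by (auto simp: compact_opens_def presented_space_def openin_topology_generated_by_iff)
  let ?\<C> = "{W \<in> presented_opens \<tau> L. W \<subseteq> K}"
  have "K \<subseteq> \<Union>?\<C>"
  proof
    fix x assume "x \<in> K"
    have "\<exists>W\<in>presented_opens \<tau> L. x \<in> W \<and> W \<subseteq> K"
      using op \<open>x \<in> K\<close>
      by (rule generate_topology_on_base) (rule presented_opens_Int[OF assms])
    then show "x \<in> \<Union>?\<C>" by blast
  qed
  moreover have "?\<C> \<subseteq> presented_opens \<tau> L" by blast
  ultimately obtain \<D> where \<D>: "\<D> \<subseteq> ?\<C>" "finite \<D>" "K \<subseteq> \<Union>\<D>"
    using c unfolding compactin_presented_space_iff[OF assms] by meson
  \<comment> \<open>The cover was taken among sets inside \<open>K\<close>, so a finite subcover has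
    union exactly \<open>K\<close>.\<close>
  then have "K = \<Union>\<D>" by blast
  then show "K \<in> presented_opens \<tau> L"
    using presented_opens_Union[OF assms \<D>(2)] \<D>(1) by blast
qed

section \<open>Normal form of Boolean combinations\<close>

text \<open>A combination involves finitely many generators, and membership depends only on which of
  them contain the point. This invariance passes directly through complements, where a normal form
  would have to be recomputed. Points are restricted to \<open>X\<close> because complements are
  relative to \<open>X\<close>.\<close>

lemma boolean_combinations_finitely_determined:
  assumes "Y \<in> boolean_combinations X C"
  obtains F where "F \<subseteq> C" "finite F"
    "\<forall>x\<in>X. \<forall>y\<in>X. (\<forall>K\<in>F. x \<in> K \<longleftrightarrow> y \<in> K) \<longrightarrow> (x \<in> Y \<longleftrightarrow> y \<in> Y)"
  using assms
proof (induction arbitrary: thesis)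
  case (base K)
  show ?case by (rule base.prems[of "{K}"]) (use base.hyps in auto)
next
  case (compl Y)
  obtain F where F: "F \<subseteq> C" "finite F"
    "\<forall>x\<in>X. \<forall>y\<in>X. (\<forall>K\<in>F. x \<in> K \<longleftrightarrow> y \<in> K) \<longrightarrow> (x \<in> Y \<longleftrightarrow> y \<in> Y)"
    using compl.IH by blast
  show ?case
  proof (rule compl.prems[OF F(1,2)])
    show "\<forall>x\<in>X. \<forall>y\<in>X. (\<forall>K\<in>F. x \<in> K \<longleftrightarrow> y \<in> K) \<longrightarrow> (x \<in> X - Y \<longleftrightarrow> y \<in> X - Y)"
    proof (intro ballI impI)
      fix x y assume xy: "x \<in> X" "y \<in> X" "\<forall>K\<in>F. x \<in> K \<longleftrightarrow> y \<in> K"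
      have "x \<in> Y \<longleftrightarrow> y \<in> Y" using F(3) xy by blast
      then show "x \<in> X - Y \<longleftrightarrow> y \<in> X - Y" using xy(1,2) by simp
    qed
  qed
next
  case (union Y Z)
  obtain F where F: "F \<subseteq> C" "finite F"
    "\<forall>x\<in>X. \<forall>y\<in>X. (\<forall>K\<in>F. x \<in> K \<longleftrightarrow> y \<in> K) \<longrightarrow> (x \<in> Y \<longleftrightarrow> y \<in> Y)"
    using union.IH(1) by blast
  obtain G where G: "G \<subseteq> C" "finite G"
    "\<forall>x\<in>X. \<forall>y\<in>X. (\<forall>K\<in>G. x \<in> K \<longleftrightarrow> y \<in> K) \<longrightarrow> (x \<in> Z \<longleftrightarrow> y \<in> Z)"
    using union.IH(2) by blast
  show ?case
  proof (rule union.prems[of "F \<union> G"])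
    show "\<forall>x\<in>X. \<forall>y\<in>X. (\<forall>K\<in>F \<union> G. x \<in> K \<longleftrightarrow> y \<in> K) \<longrightarrow> (x \<in> Y \<union> Z \<longleftrightarrow> y \<in> Y \<union> Z)"
    proof (intro ballI impI)
      fix x y assume xy: "x \<in> X" "y \<in> X" "\<forall>K\<in>F \<union> G. x \<in> K \<longleftrightarrow> y \<in> K"
      have "x \<in> Y \<longleftrightarrow> y \<in> Y" using F(3) xy by blast
      moreover have "x \<in> Z \<longleftrightarrow> y \<in> Z" using G(3) xy by blast
      ultimately show "x \<in> Y \<union> Z \<longleftrightarrow> y \<in> Y \<union> Z" by simp
    qed
  qed (use F G in auto)
next
  case (inter Y Z)
  obtain F where F: "F \<subseteq> C" "finite F"
    "\<forall>x\<in>X. \<forall>y\<in>X. (\<forall>K\<in>F. x \<in> K \<longleftrightarrow> y \<in> K) \<longrightarrow> (x \<in> Y \<longleftrightarrow> y \<in> Y)"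
    using inter.IH(1) by blast
  obtain G where G: "G \<subseteq> C" "finite G"
    "\<forall>x\<in>X. \<forall>y\<in>X. (\<forall>K\<in>G. x \<in> K \<longleftrightarrow> y \<in> K) \<longrightarrow> (x \<in> Z \<longleftrightarrow> y \<in> Z)"
    using inter.IH(2) by blast
  show ?case
  proof (rule inter.prems[of "F \<union> G"])
    show "\<forall>x\<in>X. \<forall>y\<in>X. (\<forall>K\<in>F \<union> G. x \<in> K \<longleftrightarrow> y \<in> K) \<longrightarrow> (x \<in> Y \<inter> Z \<longleftrightarrow> y \<in> Y \<inter> Z)"
    proof (intro ballI impI)
      fix x y assume xy: "x \<in> X" "y \<in> X" "\<forall>K\<in>F \<union> G. x \<in> K \<longleftrightarrow> y \<in> K"
      have "x \<in> Y \<longleftrightarrow> y \<in> Y" using F(3) xy by blast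
      moreover have "x \<in> Z \<longleftrightarrow> y \<in> Z" using G(3) xy by blast
      ultimately show "x \<in> Y \<inter> Z \<longleftrightarrow> y \<in> Y \<inter> Z" by simp
    qed
  qed (use F G in auto)
qed

text \<open>This is the disjunctive normal form: \<open>Y\<close> is the union of those atoms of the
  finite family determining it that lie inside \<open>Y\<close>.\<close>

lemma boolean_combination_Union_differences:
  assumes L: "bounded_sublattice X L" and top: "topspace \<tau> = X" and "Y \<subseteq> X"
    and "Y \<in> boolean_combinations X (presented_opens \<tau> L)"
  shows "\<exists>\<A>. finite \<A> \<and> Y = \<Union>\<A> \<and>
    (\<forall>A\<in>\<A>. \<exists>K\<in>presented_opens \<tau> L. \<exists>K'\<in>presented_opens \<tau> L. A = K - K')"
proof -
  obtain F where F: "F \<subseteq> presented_opens \<tau> L" "finite F"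
    and det: "\<forall>x\<in>X. \<forall>y\<in>X. (\<forall>K\<in>F. x \<in> K \<longleftrightarrow> y \<in> K) \<longrightarrow> (x \<in> Y \<longleftrightarrow> y \<in> Y)"
    using boolean_combinations_finitely_determined[OF assms(4)] by blast
  \<comment> \<open>For \<open>G \<subseteq> F\<close>, this is the set of points of
    \<open>X\<close> that lie in every member of \<open>G\<close> and in no other member of
    \<open>F\<close>.\<close>
  define atom where "atom G = (X \<inter> \<Inter>G) - \<Union>(F - G)" for G
  let ?\<A> = "atom ` {G. G \<subseteq> F \<and> atom G \<subseteq> Y}"
  have "Y \<subseteq> \<Union>?\<A>"
  proof
    fix x assume x: "x \<in> Y"
    \<comment> \<open>This choice gives the atom of \<open>x\<close>. Its points agree with
      \<open>x\<close> on all of \<open>F\<close>, so they belong to \<open>Y\<close> along with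
      \<open>x\<close>.\<close>
    let ?G = "{K \<in> F. x \<in> K}"
    have x_atom: "x \<in> atom ?G" using x \<open>Y \<subseteq> X\<close> by (auto simp: atom_def)
    have "atom ?G \<subseteq> Y"
    proof
      fix y assume y: "y \<in> atom ?G"
      then have "y \<in> X" "\<forall>K\<in>F. x \<in> K \<longleftrightarrow> y \<in> K" by (auto simp: atom_def)
      moreover have "x \<in> X" using x \<open>Y \<subseteq> X\<close> by blast
      ultimately show "y \<in> Y" using det[rule_format, of x y] x by blast
    qed
    then have "?G \<in> {G. G \<subseteq> F \<and> atom G \<subseteq> Y}" by simp
    then show "x \<in> \<Union>?\<A>" using x_atom by (rule UN_I)
  qed
  moreover have "\<Union>?\<A> \<subseteq> Y" by (rule UN_least) simp
  ultimately have "Y = \<Union>?\<A>" by (rule subset_antisym)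
  moreover have "finite ?\<A>" using F(2) by simp
  moreover have "\<exists>K\<in>presented_opens \<tau> L. \<exists>K'\<in>presented_opens \<tau> L. A = K - K'"
    if A: "A \<in> ?\<A>" for A
  proof -
    obtain G where G: "G \<subseteq> F" "A = atom G" using A by blast
    \<comment> \<open>The positive conditions of an atom form \<open>K\<close>, and the union of the
      sets it avoids forms \<open>K'\<close>.\<close>
    have "X \<inter> \<Inter>G \<in> presented_opens \<tau> L"
      using G F by (intro presented_opens_Inter[OF L top]) (auto intro: finite_subset)
    moreover have "\<Union>(F - G) \<in> presented_opens \<tau> L"
      using F by (intro presented_opens_Union[OF L]) auto
    ultimately show ?thesis using G(2) unfolding atom_def by blast
  qed
  ultimately show ?thesis by (intro exI[of _ ?\<A>] conjI ballI)
qed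

section \<open>Compactness on a piece and on a finite union of pieces\<close>

lemma finite_subcover_difference:
  assumes pre: "logically_presented_pre_spectral X \<tau> L"
    and K: "K \<in> presented_opens \<tau> L" and K': "K' \<in> presented_opens \<tau> L"
    and V: "V \<in> L" "openin (subtopology \<tau> (K - K')) V"
    and \<C>: "\<And>C. C \<in> \<C> \<Longrightarrow> C \<in> L \<and> openin (subtopology \<tau> (K - K')) C"
    and cover: "V \<subseteq> \<Union>\<C>"
  shows "\<exists>\<D>\<subseteq>\<C>. finite \<D> \<and> V \<subseteq> \<Union>\<D>"
proof -
  have L: "bounded_sublattice X L"
    using pre by (simp add: logically_presented_pre_spectral_def)
  let ?N = "K \<inter> K'"
  have N: "?N \<in> presented_opens \<tau> L"
    using K K' by (rule presented_opens_Int[OF L])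
  have lift: "C \<union> ?N \<in> presented_opens \<tau> L" if C: "C \<in> L" "openin (subtopology \<tau> (K - K')) C" for C
  proof -
    obtain U where U: "openin \<tau> U" "C = U \<inter> (K - K')"
      using C(2) by (auto simp: openin_subtopology)
    then have "C \<union> ?N = (U \<inter> K) \<union> ?N" by blast
    moreover have "openin \<tau> ((U \<inter> K) \<union> ?N)"
      using U(1) K K' by (auto simp: presented_opens_def)
    moreover have "C \<union> ?N \<in> L"
      using C(1) N L by (simp add: bounded_sublattice_def presented_opens_def)
    ultimately show ?thesis by (simp add: presented_opens_def)
  qed
  have VN: "V \<union> ?N \<in> presented_opens \<tau> L" using V by (rule lift)
  then have "compactin (presented_space \<tau> L) (V \<union> ?N)"
    using pre by (simp add: logically_presented_pre_spectral_def)
  \<comment> \<open>Inserting \<open>?N\<close> itself keeps this a cover even when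
    \<open>\<C>\<close> is empty.\<close>
  moreover have "insert ?N ((\<lambda>C. C \<union> ?N) ` \<C>) \<subseteq> presented_opens \<tau> L"
    using N \<C> lift by blast
  moreover have "V \<union> ?N \<subseteq> \<Union>(insert ?N ((\<lambda>C. C \<union> ?N) ` \<C>))"
    using cover by blast
  ultimately obtain \<E> where \<E>: "\<E> \<subseteq> insert ?N ((\<lambda>C. C \<union> ?N) ` \<C>)" "finite \<E>" "V \<union> ?N \<subseteq> \<Union>\<E>"
    unfolding compactin_presented_space_iff[OF L] by meson
  \<comment> \<open>Without \<open>?N\<close>, every remaining set comes from a member of
    \<open>\<C>\<close>, so a finite subfamily of \<open>\<C>\<close> can be recovered.\<close>
  have "\<E> - {?N} \<subseteq> (\<lambda>C. C \<union> ?N) ` \<C>" "finite (\<E> - {?N})" using \<E> by auto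
  then obtain \<D> where \<D>: "\<D> \<subseteq> \<C>" "finite \<D>" "\<E> - {?N} = (\<lambda>C. C \<union> ?N) ` \<D>"
    by (meson finite_subset_image)
  \<comment> \<open>\<open>V\<close> lies in \<open>K - K'\<close>, so the added set
    \<open>?N\<close> covers none of its points.\<close>
  have "V \<inter> ?N = {}" using openin_subset[OF V(2)] by auto
  moreover have "V \<subseteq> \<Union>(\<E> - {?N}) \<union> ?N" using \<E>(3) by blast
  ultimately have "V \<subseteq> \<Union>\<D>" unfolding \<D>(3) by blast
  then show ?thesis using \<D> by blast
qed

text \<open>Complements in \<open>L\<close> make the pieces, and hence \<open>Y\<close>, members of
  \<open>L\<close>. A cover of a presented open of \<open>Y\<close> can then be cut along the
  finitely many pieces and treated on each separately.\<close>

theorem logically_presented_pre_spectral_boolean_combination: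
  assumes pre: "logically_presented_pre_spectral X \<tau> L"
    and compl: "\<And>U. U \<in> L \<Longrightarrow> X - U \<in> L"
    and YX: "Y \<subseteq> X"
    and "Y \<in> boolean_combinations X (presented_opens \<tau> L)"
  shows "logically_presented_pre_spectral Y (subtopology \<tau> Y) ((\<inter>) Y ` L)"
proof -
  have L: "bounded_sublattice X L" and top: "topspace \<tau> = X"
    using pre by (simp_all add: logically_presented_pre_spectral_def)
  have L_Int: "U \<inter> V \<in> L" and L_Un: "U \<union> V \<in> L" if "U \<in> L" "V \<in> L" for U V
    using L that by (simp_all add: bounded_sublattice_def)
  have L_Diff: "U - V \<in> L" if "U \<in> L" "V \<in> L" for U V
  proof -
    have "U - V = U \<inter> (X - V)" using L that by (auto simp: bounded_sublattice_def)
    then show ?thesis using L_Int[OF that(1) compl[OF that(2)]] by simp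
  qed
  obtain \<A> where \<A>: "finite \<A>" "Y = \<Union>\<A>"
    and diff: "\<And>A. A \<in> \<A> \<Longrightarrow>
      \<exists>K\<in>presented_opens \<tau> L. \<exists>K'\<in>presented_opens \<tau> L. A = K - K'"
    using boolean_combination_Union_differences[OF L top YX assms(4)] by blast
  have A_L: "A \<in> L" if "A \<in> \<A>" for A
    using diff[OF that] L_Diff by (auto simp: presented_opens_def)
  have "\<Union>\<A> \<in> L"
    using \<A>(1) A_L
    by (induction \<A>) (use L in \<open>auto simp: bounded_sublattice_def\<close>)
  then have Y_L: "Y \<in> L" using \<A>(2) by simp
  \<comment> \<open>Because \<open>Y\<close> is in \<open>L\<close>, definability in
    \<open>Y\<close> amounts to definability in \<open>X\<close> together with inclusion in
    \<open>Y\<close>.\<close>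
  have trace: "(\<inter>) Y ` L = {U \<in> L. U \<subseteq> Y}"
    using L_Int[OF Y_L] by (auto simp: image_iff)
  have sub: "bounded_sublattice Y ((\<inter>) Y ` L)"
    using L L_Int L_Un Y_L unfolding trace bounded_sublattice_def by blast
  have "compactin (presented_space (subtopology \<tau> Y) ((\<inter>) Y ` L)) V"
    if V: "V \<in> presented_opens (subtopology \<tau> Y) ((\<inter>) Y ` L)" for V
    unfolding compactin_presented_space_iff[OF sub]
  proof (intro conjI allI impI)
    show "V \<subseteq> \<Union>(presented_opens (subtopology \<tau> Y) ((\<inter>) Y ` L))"
      using V by blast
    fix \<C> assume \<C>: "\<C> \<subseteq> presented_opens (subtopology \<tau> Y) ((\<inter>) Y ` L)" and cover: "V \<subseteq> \<Union>\<C>"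
    \<comment> \<open>These are the conditions under which \<open>finite_subcover_difference\<close>
      applies to the trace of \<open>V\<close> and of its cover on a piece.\<close>
    have restrict: "C \<inter> A \<in> L \<and> openin (subtopology \<tau> A) (C \<inter> A)"
      if C: "C \<in> presented_opens (subtopology \<tau> Y) ((\<inter>) Y ` L)" and A: "A \<in> \<A>" for C A
    proof
      show "C \<inter> A \<in> L"
        using C A_L[OF A] L_Int unfolding trace presented_opens_def by blast
      have "A \<subseteq> Y" using A \<A>(2) by blast
      obtain U where "openin \<tau> U" "C = U \<inter> Y"
        using C by (auto simp: presented_opens_def openin_subtopology)
      moreover from this \<open>A \<subseteq> Y\<close> have "C \<inter> A = U \<inter> A" by blast
      ultimately show "openin (subtopology \<tau> A) (C \<inter> A)"
        by (auto simp: openin_subtopology)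
    qed
    have "\<exists>\<D>\<subseteq>\<C>. finite \<D> \<and> V \<inter> A \<subseteq> \<Union>\<D>" if A: "A \<in> \<A>" for A
    proof -
      obtain K K' where K: "K \<in> presented_opens \<tau> L" "K' \<in> presented_opens \<tau> L" "A = K - K'"
        using diff[OF A] by blast
      have "\<exists>\<E>\<subseteq>(\<lambda>C. C \<inter> A) ` \<C>. finite \<E> \<and> V \<inter> A \<subseteq> \<Union>\<E>"
      proof (rule finite_subcover_difference[OF pre K(1,2)])
        show "V \<inter> A \<in> L" "openin (subtopology \<tau> (K - K')) (V \<inter> A)"
          using restrict[OF V A] K(3) by simp_all
        show "C \<in> L \<and> openin (subtopology \<tau> (K - K')) C" if "C \<in> (\<lambda>C. C \<inter> A) ` \<C>" for C
          using that restrict[OF _ A] \<C> K(3) by blast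
        show "V \<inter> A \<subseteq> \<Union>((\<lambda>C. C \<inter> A) ` \<C>)" using cover by blast
      qed
      then obtain \<E> where \<E>: "\<E> \<subseteq> (\<lambda>C. C \<inter> A) ` \<C>" "finite \<E>" "V \<inter> A \<subseteq> \<Union>\<E>" by blast
      then obtain \<D> where \<D>: "\<D> \<subseteq> \<C>" "finite \<D>" "\<E> = (\<lambda>C. C \<inter> A) ` \<D>"
        by (meson finite_subset_image)
      \<comment> \<open>Passing from the traces \<open>C \<inter> A\<close> back to the sets
        \<open>C\<close> only enlarges the cover.\<close>
      have "V \<inter> A \<subseteq> \<Union>\<D>" using \<E>(3) unfolding \<D>(3) by blast
      then show ?thesis using \<D> by blast
    qed
    then obtain d where d: "\<And>A. A \<in> \<A> \<Longrightarrow> d A \<subseteq> \<C> \<and> finite (d A) \<and> V \<inter> A \<subseteq> \<Union>(d A)"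
      by metis
    have "V \<subseteq> \<Union>\<A>" using V \<A>(2) unfolding trace presented_opens_def by blast
    then have "V \<subseteq> \<Union>(\<Union>(d ` \<A>))" using d by blast
    moreover have "\<Union>(d ` \<A>) \<subseteq> \<C>" "finite (\<Union>(d ` \<A>))" using d \<A>(1) by blast+
    ultimately show "\<exists>\<D>\<subseteq>\<C>. finite \<D> \<and> V \<subseteq> \<Union>\<D>" by blast
  qed
  then show ?thesis
    using sub top YX by (auto simp: logically_presented_pre_spectral_def)
qed

section \<open>First-order definable sets\<close>

lemma FO_compl:
  assumes "U \<in> FO \<sigma> X"
  shows "X - U \<in> FO \<sigma> X"
proof -
  obtain \<phi> where \<phi>: "fo_sentence \<sigma> \<phi>" "U = models_in X \<phi>"
    using assms by (auto simp: FO_def)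
  have neg: "fo_sentence \<sigma> (Neg \<phi>)" using \<phi>(1) by (simp add: fo_sentence_def)
  \<comment> \<open>\<open>models\<close> quantifies over all valuations. Negation commutes with it
    here because the truth of a sentence is the same under every valuation.\<close>
  have "models A (Neg \<phi>) \<longleftrightarrow> \<not> models A \<phi>" for A
    using models_sentence[OF neg, of A] models_sentence[OF \<phi>(1), of A] by simp
  then have "X - U = models_in X (Neg \<phi>)" using \<phi>(2) by (auto simp: models_in_def)
  then show ?thesis using neg by (auto simp: FO_def)
qed

text \<open>Satisfaction depends on the structure alone and not on the ambient set. This matches
  \<open>FO \<sigma> Y\<close> with the lattice of traces in the general theorem.\<close>

lemma FO_subset: "Y \<subseteq> X \<Longrightarrow> FO \<sigma> Y = (\<inter>) Y ` FO \<sigma> X"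
proof -
  assume "Y \<subseteq> X"
  then have "models_in Y \<phi> = Y \<inter> models_in X \<phi>" for \<phi> by (auto simp: models_in_def)
  then show ?thesis by (auto simp: FO_def image_iff)
qed

lemma boolean_combinations_mono:
  assumes "Y \<in> boolean_combinations X C" "C \<subseteq> D"
  shows "Y \<in> boolean_combinations X D"
  using assms(1) by induction (use assms(2) in \<open>auto intro: boolean_combinations.intros\<close>)

theorem proposition5p6:
  fixes \<sigma> :: "'r rel_signature"
    and X Y :: "('r, 'a) rel_structure set"
    and \<tau> \<theta> :: "('r, 'a) rel_structure topology"
  assumes "finite_signature \<sigma>"
    and "\<And>A. A \<in> X \<Longrightarrow> is_structure \<sigma> A"
    and "topspace \<tau> = X"
    and "logically_presented_pre_spectral X \<tau> (FO \<sigma> X)"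
    and "Y \<subseteq> X"
    and "Y \<in> boolean_combinations X (compact_opens (presented_space \<tau> (FO \<sigma> X)))"
    and "\<theta> = subtopology \<tau> Y"
  shows "logically_presented_pre_spectral Y \<theta> (FO \<sigma> Y)"
proof -
  have "bounded_sublattice X (FO \<sigma> X)"
    using assms(4) by (simp add: logically_presented_pre_spectral_def)
  \<comment> \<open>Compact-opens are presented opens, so \<open>Y\<close> is built from open sets
    that are also definable.\<close>
  then have "Y \<in> boolean_combinations X (presented_opens \<tau> (FO \<sigma> X))"
    using assms(6) compact_opens_presented_space by (blast intro: boolean_combinations_mono)
  then show ?thesis
    using logically_presented_pre_spectral_boolean_combination[OF assms(4) FO_compl assms(5)]
    by (simp add: assms(7) FO_subset[OF assms(5)])
qed

end
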